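(* Let $n\ge 1$, let $y_{1,n-1}<\cdots<y_{n-1,n-1}$ be the zeros of the associated polynomial $p_{n-1}^{(1)}$ and $x_{1,n}<\cdots<x_{n,n}$ the zeros of $p_n$, where $(p_m)_{m\ge0}$ are the orthonormal polynomials of $\mu$ with recurrence coefficients $(a_{m+1},b_m)_{m\ge0}$. Then $$\begin{pmatrix} y_{1,n-1}\\ y_{2,n-1}\\ \vdots\\ y_{n-1,n-1}\\ b_0\end{pmatrix} = B\begin{pmatrix} x_{1,n}\\ x_{2,n}\\ \vdots\\ x_{n-1,n}\\ x_{n,n}\end{pmatrix},$$ where $B=(b_{i,j})_{i,j=1}^n$ is a doubly stochastic matrix with entries, for $1\le j\le n$, $$b_{i,j}=\begin{cases}\displaystyle a_1^2\,\frac{\lambda_{j,n}\,\lambda_{i,n-1}^{(1)}}{(y_{i,n-1}-x_{j,n})^2}, & 1\le i\le n-1,\\[10pt] \lambda_{j,n}, & i=n,\end{cases}$$ where $\lambda_{i,n-1}^{(1)}$ are the Christoffel numbers of the polynomial $p_{n-1}^{(1)}$ for the measure $\mu^{(1)}$.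
   Context: $\mu$ is a probability measure on $\mathbb{R}$ with infinite support and all moments finite. The orthonormal polynomials $p_m(x)=\gamma_m x^m+\cdots$, $\gamma_m>0$, satisfy $\int p_m p_l\,d\mu=\delta_{m,l}$ and the three-term recurrence $x p_m(x)=a_{m+1}p_{m+1}(x)+b_m p_m(x)+a_m p_{m-1}(x)$ for $m\ge 0$ (with $p_{-1}=0$), where $a_m=\int x p_m p_{m-1}\,d\mu=\gamma_{m-1}/\gamma_m>0$ for $m\ge1$ and $b_m=\int x p_m^2\,d\mu$ for $m\ge0$. The polynomial $p_m$ has $m$ real simple zeros $x_{1,m}<\cdots<x_{m,m}$, with Christoffel numbers $\lambda_{j,m}=1/\sum_{l=0}^{m-1}p_l^2(x_{j,m})$. The associated polynomials are $p_{m-1}^{(1)}(z)=a_1\int\frac{p_m(z)-p_m(x)}{z-x}\,d\mu(x)$, $m\ge1$. Equivalently, they satisfy the recurrence with coefficients shifted by one: $p_0^{(1)}=1$, $p_{-1}^{(1)}=0$, $x p_m^{(1)}(x)=a_{m+2}p_{m+1}^{(1)}(x)+b_{m+1}p_m^{(1)}(x)+a_{m+1}p_{m-1}^{(1)}(x)$; hence they are orthonormal with respect to some probability measure $\mu^{(1)}$ on $\mathbb{R}$. The polynomial $p_{n-1}^{(1)}$ has $n-1$ real simple zeros, which strictly interlace with the zeros of $p_n$, and its Christoffel numbers are $\lambda_{i,n-1}^{(1)}=1/\sum_{l=0}^{n-2}[p_l^{(1)}(y_{i,n-1})]^2$. A square matrix is doubly stochastic if its entries are nonnegative and every row and every column sums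 to $1$. (The matrix entries $b_{i,j}$, with two indices, are not to be confused with the recurrence coefficients $b_m$.) *)

theory Defs
  imports
    "HOL-Probability.Probability"
    "HOL-Computational_Algebra.Polynomial"
    "Jordan_Normal_Form.Matrix"
begin

definition measure_support :: "'a::topological_space measure \<Rightarrow> 'a set" where
  "measure_support M = {x. \<forall>U. open U \<longrightarrow> x \<in> U \<longrightarrow> 0 < emeasure M U}"

definition orthonormal_polys :: "real measure \<Rightarrow> (nat \<Rightarrow> real poly) \<Rightarrow> bool" where
  "orthonormal_polys M p \<longleftrightarrow>
     (\<forall>m. degree (p m) = m \<and> lead_coeff (p m) > 0) \<and>
     (\<forall>m l. (\<integral>x. poly (p m) x * poly (p l) x \<partial>M) = (if m = l then 1 else 0))"

text \<open>The coefficient \<open>recur_a M p m\<close> is meaningful for \<open>m \<ge> 1\<close> only: \<open>m - 1\<close> is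
  truncated at \<open>m = 0\<close>.\<close>

definition recur_a :: "real measure \<Rightarrow> (nat \<Rightarrow> real poly) \<Rightarrow> nat \<Rightarrow> real" where
  "recur_a M p m = (\<integral>x. x * poly (p m) x * poly (p (m - 1)) x \<partial>M)"

definition recur_b :: "real measure \<Rightarrow> (nat \<Rightarrow> real poly) \<Rightarrow> nat \<Rightarrow> real" where
  "recur_b M p m = (\<integral>x. x * (poly (p m) x)\<^sup>2 \<partial>M)"

text \<open>The difference quotient \<open>(q(z) - q(x)) / (z - x)\<close> is a polynomial in \<open>x\<close> and \<open>z\<close>, so on the
  diagonal it is \<open>q'(z)\<close>. This value matters, since the measure may have an atom at \<open>z\<close>.\<close>

definition diff_quot :: "real poly \<Rightarrow> real \<Rightarrow> real \<Rightarrow> real" where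
  "diff_quot q z x =
     (if x = z then poly (pderiv q) z else (poly q z - poly q x) / (z - x))"

text \<open>The associated polynomial of degree \<open>k\<close> comes from \<open>p (k + 1)\<close>.\<close>

definition assoc_poly :: "real measure \<Rightarrow> (nat \<Rightarrow> real poly) \<Rightarrow> nat \<Rightarrow> real \<Rightarrow> real" where
  "assoc_poly M p k z = recur_a M p 1 * (\<integral>x. diff_quot (p (Suc k)) z x \<partial>M)"

text \<open>The \<open>j\<close>-th smallest zero, counted from \<open>1\<close>.\<close>

definition nth_zero :: "(real \<Rightarrow> real) \<Rightarrow> nat \<Rightarrow> real" where
  "nth_zero f j = sorted_list_of_set {z. f z = 0} ! (j - 1)"

text \<open>For a sequence \<open>q\<close> of orthonormal polynomials with respect to some measure, this is the
  Christoffel number of \<open>q m\<close> at its zero \<open>t\<close>.\<close>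

definition christoffel :: "(nat \<Rightarrow> real \<Rightarrow> real) \<Rightarrow> nat \<Rightarrow> real \<Rightarrow> real" where
  "christoffel q m t = 1 / (\<Sum>l<m. (q l t)\<^sup>2)"

definition doubly_stochastic :: "real mat \<Rightarrow> bool" where
  "doubly_stochastic A \<longleftrightarrow>
     square_mat A \<and>
     (\<forall>i<dim_row A. \<forall>j<dim_col A. 0 \<le> A $$ (i, j)) \<and>
     (\<forall>i<dim_row A. (\<Sum>j<dim_col A. A $$ (i, j)) = 1) \<and>
     (\<forall>j<dim_col A. (\<Sum>i<dim_row A. A $$ (i, j)) = 1)"

text \<open>Entries are indexed from \<open>1\<close>, with \<open>x = x\<^bsub>j,n\<^esub>\<close> and \<open>y = y\<^bsub>i,n-1\<^esub>\<close>.\<close>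

definition stoch_entry ::
    "real measure \<Rightarrow> (nat \<Rightarrow> real poly) \<Rightarrow> nat \<Rightarrow> nat \<Rightarrow> nat \<Rightarrow> real" where
  "stoch_entry M p n i j =
     (let x = nth_zero (poly (p n)) j;
          y = nth_zero (assoc_poly M p (n - 1)) i;
          lam = christoffel (\<lambda>l. poly (p l)) n x;
          lam1 = christoffel (assoc_poly M p) (n - 1) y
      in if i < n then (recur_a M p 1)\<^sup>2 * (lam * lam1) / (y - x)\<^sup>2 else lam)"

text \<open>Matrices and vectors of the library are indexed from \<open>0\<close>.\<close>

definition stoch_mat :: "real measure \<Rightarrow> (nat \<Rightarrow> real poly) \<Rightarrow> nat \<Rightarrow> real mat" where
  "stoch_mat M p n = Matrix.mat n n (\<lambda>(i, j). stoch_entry M p n (Suc i) (Suc j))"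

definition zeros_vec :: "(nat \<Rightarrow> real poly) \<Rightarrow> nat \<Rightarrow> real Matrix.vec" where
  "zeros_vec p n = Matrix.vec n (\<lambda>j. nth_zero (poly (p n)) (Suc j))"

definition assoc_zeros_vec ::
    "real measure \<Rightarrow> (nat \<Rightarrow> real poly) \<Rightarrow> nat \<Rightarrow> real Matrix.vec" where
  "assoc_zeros_vec M p n =
     Matrix.vec n (\<lambda>i. if Suc i < n then nth_zero (assoc_poly M p (n - 1)) (Suc i)
                       else recur_b M p 0)"

end

theory Submission
  imports
    Defs
    "HOL-Computational_Algebra.Fundamental_Theorem_Algebra"
    "Jordan_Normal_Form.Determinant"
begin

text \<open>
  The vectors \<open>u\<^sub>j = sqrt \<lambda>\<^sub>j * (p\<^sub>0(x\<^sub>j), \<dots>, p\<^bsub>n-1\<^esub>(x\<^sub>j))\<close> form an orthonormal basis of eigenvectors of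
  the Jacobi matrix of \<open>\<mu>\<close>. A second orthonormal basis consists of the analogous eigenvectors of the
  Jacobi matrix with first row and column deleted, padded with a leading \<open>0\<close>, and the first unit
  vector. Up to sign, the inner products of the two bases are the square roots of the \<open>b\<^sub>i\<^sub>j\<close>, by a
  Christoffel-Darboux identity mixing \<open>p\<close> with its associated polynomials. So \<open>B\<close> arises from an
  orthogonal matrix by squaring the entries, and is doubly stochastic. The vector identity reads off
  the diagonal of the Jacobi quadratic form in the second basis.
\<close>

hide_const (open) module.smult

section \<open>Three-term recurrences\<close>

text \<open>The point \<open>x\<close> is fixed and the values lie in any commutative ring, so real
  and complex polynomials and, with shifted coefficients, the associated polynomials all fit. At
  index \<open>0\<close> the missing predecessor counts as zero, and \<open>u 0\<close> is left
  free.\<close>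

definition three_term :: "(nat \<Rightarrow> 'a) \<Rightarrow> (nat \<Rightarrow> 'a) \<Rightarrow> 'a \<Rightarrow> (nat \<Rightarrow> 'a::comm_ring_1) \<Rightarrow> bool" where
  "three_term a b x u \<longleftrightarrow>
     x * u 0 = a 1 * u 1 + b 0 * u 0 \<and>
     (\<forall>m. x * u (Suc m) = a (Suc (Suc m)) * u (Suc (Suc m)) + b (Suc m) * u (Suc m)
            + a (Suc m) * u m)"

lemma three_term_0: "three_term a b x u \<Longrightarrow> x * u 0 = a 1 * u 1 + b 0 * u 0"
  by (simp add: three_term_def)

lemma three_term_Suc:
  "three_term a b x u \<Longrightarrow>
     x * u (Suc m) = a (Suc (Suc m)) * u (Suc (Suc m)) + b (Suc m) * u (Suc m) + a (Suc m) * u m"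
  by (simp add: three_term_def)

text \<open>Dividing by \<open>a (Suc m)\<close> makes the initial value determine the sequence.
  Sequences given in different ways are identified through this.\<close>

lemma three_term_unique:
  fixes u v :: "nat \<Rightarrow> 'a::field"
  assumes u: "three_term a b x u" and v: "three_term a b x v"
    and eq0: "u 0 = v 0" and a: "\<And>m. a (Suc m) \<noteq> 0"
  shows "u m = v m"
proof (induction m rule: less_induct)
  case (less m)
  consider "m = 0" | "m = 1" | k where "m = Suc (Suc k)"
    by (metis One_nat_def not0_implies_Suc)
  then show ?case
  proof cases
    case 1
    then show ?thesis using eq0 by simp
  next
    case 2
    then show ?thesis
      using three_term_0[OF u] three_term_0[OF v] eq0 a[of 0] by simp
  next
    case (3 k)
    then have "u k = v k" "u (Suc k) = v (Suc k)"
      using less by auto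
    then show ?thesis
      using three_term_Suc[OF u, of k] three_term_Suc[OF v, of k] a[of "Suc k"] 3 by simp
  qed
qed

text \<open>Multiplying each recurrence by the other sequence and subtracting cancels the
  \<open>b\<close> terms, and the \<open>a\<close> terms telescope.\<close>

lemma christoffel_darboux:
  assumes u: "three_term a b x u" and v: "three_term a b y v"
  shows "(x - y) * (\<Sum>l<Suc n. u l * v l) = a (Suc n) * (u (Suc n) * v n - u n * v (Suc n))"
proof (induction n)
  case 0
  have "(x - y) * (u 0 * v 0) = (x * u 0) * v 0 - u 0 * (y * v 0)"
    by (simp add: algebra_simps)
  then show ?case
    unfolding three_term_0[OF u] three_term_0[OF v] by (simp add: algebra_simps)
next
  case (Suc n)
  have "(x - y) * (u (Suc n) * v (Suc n)) = (x * u (Suc n)) * v (Suc n) - u (Suc n) * (y * v (Suc n))"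
    by (simp add: algebra_simps)
  then have "(x - y) * (\<Sum>l<Suc (Suc n). u l * v l) =
      a (Suc n) * (u (Suc n) * v n - u n * v (Suc n))
      + ((x * u (Suc n)) * v (Suc n) - u (Suc n) * (y * v (Suc n)))"
    unfolding Suc[symmetric] by (simp add: algebra_simps)
  then show ?case
    unfolding three_term_Suc[OF u] three_term_Suc[OF v] by (simp add: algebra_simps)
qed

text \<open>The shifted sequence \<open>u (Suc l)\<close> has the coefficients of \<open>w\<close>,
  so the sum telescopes as before. Only the recurrence of \<open>u\<close> at index \<open>1\<close>
  has a predecessor term, \<open>a 1 * u 0\<close>, without counterpart for \<open>w\<close>; it
  leaves the boundary term.\<close>

lemma christoffel_darboux_shifted:
  assumes u: "three_term a b x u" and w: "three_term (\<lambda>m. a (Suc m)) (\<lambda>m. b (Suc m)) y w"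
  shows "(x - y) * (\<Sum>l<Suc n. u (Suc l) * w l) =
    a (Suc (Suc n)) * (u (Suc (Suc n)) * w n - u (Suc n) * w (Suc n)) + a 1 * u 0 * w 0"
proof (induction n)
  case 0
  have "(x - y) * (u (Suc 0) * w 0) = (x * u (Suc 0)) * w 0 - u (Suc 0) * (y * w 0)"
    by (simp add: algebra_simps)
  then show ?case
    unfolding three_term_Suc[OF u] three_term_0[OF w] by (simp add: algebra_simps)
next
  case (Suc n)
  let ?k = "Suc (Suc n)"
  have "(x - y) * (u ?k * w (Suc n)) = (x * u ?k) * w (Suc n) - u ?k * (y * w (Suc n))"
    by (simp add: algebra_simps)
  then have "(x - y) * (\<Sum>l<?k. u (Suc l) * w l) =
      a ?k * (u ?k * w n - u (Suc n) * w (Suc n)) + a 1 * u 0 * w 0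
      + ((x * u ?k) * w (Suc n) - u ?k * (y * w (Suc n)))"
    unfolding Suc[symmetric] by (simp add: algebra_simps)
  then show ?case
    unfolding three_term_Suc[OF u] three_term_Suc[OF w] by (simp add: algebra_simps)
qed

text \<open>The assumptions on \<open>d\<close> are the recurrence of \<open>u\<close>, differentiated in \<open>x\<close>.\<close>

lemma christoffel_darboux_confluent:
  assumes u: "three_term a b x u"
    and d0: "u 0 + x * d 0 = a 1 * d 1 + b 0 * d 0"
    and d: "\<And>m. u (Suc m) + x * d (Suc m) =
      a (Suc (Suc m)) * d (Suc (Suc m)) + b (Suc m) * d (Suc m) + a (Suc m) * d m"
  shows "(\<Sum>l<Suc n. u l * u l) = a (Suc n) * (d (Suc n) * u n - d n * u (Suc n))"
proof (induction n)
  case 0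
  have "u 0 * u 0 = (u 0 + x * d 0) * u 0 - d 0 * (x * u 0)"
    by (simp add: algebra_simps)
  then show ?case
    unfolding d0 three_term_0[OF u] by (simp add: algebra_simps)
next
  case (Suc n)
  have "u (Suc n) * u (Suc n) = (u (Suc n) + x * d (Suc n)) * u (Suc n) - d (Suc n) * (x * u (Suc n))"
    by (simp add: algebra_simps)
  then have "(\<Sum>l<Suc (Suc n). u l * u l) = a (Suc n) * (d (Suc n) * u n - d n * u (Suc n))
      + ((u (Suc n) + x * d (Suc n)) * u (Suc n) - d (Suc n) * (x * u (Suc n)))"
    unfolding Suc[symmetric] by (simp add: algebra_simps)
  then show ?case
    unfolding d three_term_Suc[OF u] by (simp add: algebra_simps)
qed

section \<open>Polynomials generated by a recurrence and their zeros\<close>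

fun rec_poly :: "(nat \<Rightarrow> 'a::field) \<Rightarrow> (nat \<Rightarrow> 'a) \<Rightarrow> nat \<Rightarrow> 'a poly" where
  "rec_poly a b 0 = 1"
| "rec_poly a b (Suc 0) = smult (1 / a 1) [:- b 0, 1:]"
| "rec_poly a b (Suc (Suc m)) = smult (1 / a (Suc (Suc m)))
     ([:- b (Suc m), 1:] * rec_poly a b (Suc m) - smult (a (Suc m)) (rec_poly a b m))"

lemma three_term_rec_poly:
  fixes a :: "nat \<Rightarrow> 'a::field"
  assumes "\<And>m. a (Suc m) \<noteq> 0"
  shows "three_term a b x (\<lambda>m. poly (rec_poly a b m) x)"
  using assms assms[of 0] by (simp add: three_term_def field_simps)

lemma degree_rec_poly:
  fixes a :: "nat \<Rightarrow> 'a::field"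
  assumes a: "\<And>m. a (Suc m) \<noteq> 0"
  shows "degree (rec_poly a b m) = m"
  using a
proof (induction a b m rule: rec_poly.induct)
  case (3 a b m)
  then have deg: "degree (rec_poly a b (Suc m)) = Suc m" "degree (rec_poly a b m) = m"
    by auto
  then have "rec_poly a b (Suc m) \<noteq> 0"
    by auto
  then have "degree ([:- b (Suc m), 1:] * rec_poly a b (Suc m)) = Suc (Suc m)"
    using deg by (subst degree_mult_eq) auto
  then have "degree ([:- b (Suc m), 1:] * rec_poly a b (Suc m)
      - smult (a (Suc m)) (rec_poly a b m)) = Suc (Suc m)"
    unfolding diff_conv_add_uminus
    by (subst degree_add_eq_left) (use deg in \<open>auto simp del: mult_pCons_left\<close>)
  then show ?case
    using 3(3)[of "Suc m"] by simp
qed auto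

text \<open>These are the premises on \<open>d\<close> in
  \<open>christoffel_darboux_confluent\<close>.\<close>

lemma pderiv_rec_poly:
  fixes a b :: "nat \<Rightarrow> 'a::field_char_0" and x :: 'a
  assumes a: "\<And>m. a (Suc m) \<noteq> 0"
  defines "u \<equiv> \<lambda>m. poly (rec_poly a b m) x" and "d \<equiv> \<lambda>m. poly (pderiv (rec_poly a b m)) x"
  shows "u 0 + x * d 0 = a 1 * d 1 + b 0 * d 0"
    and "u (Suc m) + x * d (Suc m) =
      a (Suc (Suc m)) * d (Suc (Suc m)) + b (Suc m) * d (Suc m) + a (Suc m) * d m"
  using a a[of 0]
  by (simp_all add: u_def d_def pderiv_smult pderiv_diff pderiv_add pderiv_mult pderiv_pCons field_simps
      del: mult_pCons_left)

text \<open>A zero of \<open>rec_poly a b n\<close> in the complex plane is real by the Christoffel-Darboux identity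
  at that zero and its conjugate, and simple by the confluent identity.\<close>

lemma card_zeros_rec_poly:
  fixes a b :: "nat \<Rightarrow> real"
  assumes pos: "\<And>m. 0 < a (Suc m)"
  shows "card {x. poly (rec_poly a b n) x = 0} = n"
proof (cases n)
  case (Suc k)
  \<comment> \<open>The same recurrence is run over the complex numbers, where \<open>P n\<close>
    splits into linear factors.\<close>
  define A B where "A = (\<lambda>m. complex_of_real (a m))" and "B = (\<lambda>m. complex_of_real (b m))"
  define P where "P = rec_poly A B"
  have nz: "A (Suc m) \<noteq> 0" for m
    using pos[of m] by (simp add: A_def)
  have nzr: "a (Suc m) \<noteq> 0" for m
    using pos[of m] by simp
  have tt: "three_term A B z (\<lambda>m. poly (P m) z)" for z
    unfolding P_def by (rule three_term_rec_poly) (rule nz)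
  have real: "poly (P m) (of_real x) = of_real (poly (rec_poly a b m) x)" for m x
  proof (rule three_term_unique[OF tt _ _ nz])
    show "three_term A B (of_real x) (\<lambda>m. of_real (poly (rec_poly a b m) x))"
      using three_term_rec_poly[of a b x, OF nzr]
      unfolding three_term_def A_def B_def by (simp del: rec_poly.simps flip: of_real_mult of_real_add)
  qed (simp add: P_def)
  have cnj: "poly (P m) (cnj z) = cnj (poly (P m) z)" for m z
  proof (rule three_term_unique[OF tt _ _ nz])
    have "cnj z * cnj (poly (P 0) z) = cnj (A 1 * poly (P 1) z + B 0 * poly (P 0) z)"
      by (simp only: complex_cnj_mult[symmetric] three_term_0[OF tt])
    moreover have "cnj z * cnj (poly (P (Suc m)) z) =
        cnj (A (Suc (Suc m)) * poly (P (Suc (Suc m))) z + B (Suc m) * poly (P (Suc m)) z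
          + A (Suc m) * poly (P m) z)" for m
      by (simp only: complex_cnj_mult[symmetric] three_term_Suc[OF tt])
    ultimately show "three_term A B (cnj z) (\<lambda>m. cnj (poly (P m) z))"
      unfolding three_term_def by (simp add: A_def B_def)
  qed (simp add: P_def)
  \<comment> \<open>This is the sum in the Christoffel-Darboux identity at \<open>z\<close> and
    \<open>cnj z\<close>: a sum of squared moduli whose term at \<open>0\<close> is
    \<open>1\<close>.\<close>
  have sum_nz: "(\<Sum>l<Suc k. poly (P l) z * cnj (poly (P l) z)) \<noteq> 0" for z
  proof -
    have "(\<Sum>l<Suc k. (cmod (poly (P l) z))\<^sup>2) > 0"
      by (rule sum_pos2[of _ 0]) (auto simp: P_def)
    moreover have "(\<Sum>l<Suc k. poly (P l) z * cnj (poly (P l) z)) =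
        of_real (\<Sum>l<Suc k. (cmod (poly (P l) z))\<^sup>2)"
      by (simp only: complex_norm_square of_real_sum)
    ultimately show ?thesis
      by (metis less_irrefl of_real_eq_0_iff)
  qed
  have fixed: "cnj z = z" if z: "poly (P n) z = 0" for z
    using christoffel_darboux[OF tt[of z] tt[of "cnj z"], of k] z sum_nz[of z]
    by (simp add: cnj Suc)
  have simple: "poly (pderiv (P n)) z \<noteq> 0" if z: "poly (P n) z = 0" for z
  proof
    assume d: "poly (pderiv (P n)) z = 0"
    have "(\<Sum>l<Suc k. poly (P l) z * poly (P l) z) = 0"
      using christoffel_darboux_confluent[OF tt[of z], of "\<lambda>m. poly (pderiv (P m)) z" k]
        pderiv_rec_poly[where a = A and b = B and x = z, OF nz] z d
      by (simp add: P_def Suc del: rec_poly.simps)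
    \<comment> \<open>At a real zero the values are self-conjugate, so the vanishing sum of squares
      would be the nonzero sum of \<open>sum_nz\<close>.\<close>
    moreover have "cnj (poly (P l) z) = poly (P l) z" for l
      using cnj[of l z] fixed[OF z] by simp
    ultimately show False
      using sum_nz[of z] by simp
  qed
  have deg: "degree (P n) = n"
    unfolding P_def by (rule degree_rec_poly) (rule nz)
  then have P0: "P n \<noteq> 0"
    using Suc by auto
  have "rsquarefree (P n)"
    using simple by (auto simp: rsquarefree_roots)
  then have split: "smult (lead_coeff (P n)) (\<Prod>z|poly (P n) z = 0. [:-z, 1:]) = P n"
    by (rule complex_poly_decompose_rsquarefree)
  \<comment> \<open>Without repeated factors there is one linear factor per zero, so comparing
    degrees counts the complex zeros, all of which are real.\<close>
  have "n = degree (smult (lead_coeff (P n)) (\<Prod>z|poly (P n) z = 0. [:-z, 1:]))"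
    unfolding split using deg by simp
  also have "\<dots> = degree (\<Prod>z|poly (P n) z = 0. [:-z, 1:])"
    using P0 by (simp only: degree_smult_eq leading_coeff_0_iff if_False)
  also have "\<dots> = card {z. poly (P n) z = 0}"
    by (subst degree_prod_eq_sum_degree) auto
  also have "{z. poly (P n) z = 0} = complex_of_real ` {x. poly (rec_poly a b n) x = 0}"
  proof safe
    fix z
    assume z: "poly (P n) z = 0"
    then obtain x where "z = of_real x"
      using fixed[OF z] by (metis Reals_cases Reals_cnj_iff)
    then show "z \<in> complex_of_real ` {x. poly (rec_poly a b n) x = 0}"
      using z real[of n x] by auto
  qed (simp add: real)
  also have "card \<dots> = card {x. poly (rec_poly a b n) x = 0}"
    by (rule card_image) (simp add: inj_on_def)
  finally show ?thesis ..
qed simp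

text \<open>As \<open>q n\<close> has exactly \<open>n\<close> zeros, the sorted list has
  \<open>n\<close> distinct entries. Taking functions for \<open>q\<close> covers the associated
  polynomials, which are given by integrals.\<close>

lemma nth_zero_three_term:
  fixes a b :: "nat \<Rightarrow> real" and q :: "nat \<Rightarrow> real \<Rightarrow> real"
  assumes pos: "\<And>m. 0 < a (Suc m)" and q: "\<And>x. three_term a b x (\<lambda>m. q m x)"
    and q0: "\<And>x. q 0 x = 1"
  shows "j < n \<Longrightarrow> q n (nth_zero (q n) (Suc j)) = 0"
    and "i < n \<Longrightarrow> j < n \<Longrightarrow> nth_zero (q n) (Suc i) = nth_zero (q n) (Suc j) \<longleftrightarrow> i = j"
proof -
  let ?Z = "{x. q n x = 0}"
  have nz: "a (Suc m) \<noteq> 0" for m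
    using pos[of m] by simp
  have eq: "q m x = poly (rec_poly a b m) x" for m x
    by (rule three_term_unique[OF q three_term_rec_poly _ nz]) (simp_all add: q0 nz)
  have card: "card ?Z = n"
    unfolding eq by (rule card_zeros_rec_poly) (rule pos)
  \<comment> \<open>\<open>card\<close> is \<open>0\<close> on infinite sets, so the count gives
    finiteness only for \<open>n > 0\<close>; for \<open>n = 0\<close> the set is empty.\<close>
  have fin: "finite ?Z"
  proof (cases n)
    case 0
    then show ?thesis by (simp add: q0)
  next
    case (Suc k)
    then show ?thesis using card card.infinite by fastforce
  qed
  then have set: "set (sorted_list_of_set ?Z) = ?Z" and len: "length (sorted_list_of_set ?Z) = n"
    using card by simp_all
  show "q n (nth_zero (q n) (Suc j)) = 0" if "j < n"
    using nth_mem[of j "sorted_list_of_set ?Z"] that by (simp only: set len nth_zero_def) simp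
  show "nth_zero (q n) (Suc i) = nth_zero (q n) (Suc j) \<longleftrightarrow> i = j" if "i < n" "j < n"
    using nth_eq_iff_index_eq[of "sorted_list_of_set ?Z" i j] that len
    by (simp add: nth_zero_def)
qed

section \<open>Christoffel numbers as normalising factors\<close>

lemma sum_squares_pos:
  fixes q :: "nat \<Rightarrow> real \<Rightarrow> real"
  assumes "q 0 x = 1" "0 < n"
  shows "0 < (\<Sum>l<n. (q l x)\<^sup>2)"
  by (rule sum_pos2[of _ 0]) (use assms in auto)

lemma christoffel_nonneg: "0 \<le> christoffel q n x"
  by (simp add: christoffel_def sum_nonneg)

text \<open>At distinct zeros the right-hand side of the Christoffel-Darboux identity vanishes; at
  equal ones the Christoffel number is the reciprocal of the sum of squares.\<close>

lemma christoffel_orthonormal: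
  fixes q :: "nat \<Rightarrow> real \<Rightarrow> real"
  assumes q: "\<And>x. three_term a b x (\<lambda>m. q m x)" and q0: "\<And>x. q 0 x = 1"
    and x: "q n x = 0" and y: "q n y = 0"
  shows "(\<Sum>l<n. (sqrt (christoffel q n x) * q l x) * (sqrt (christoffel q n y) * q l y)) =
    of_bool (x = y)"
proof -
  have "n \<noteq> 0"
    using x q0 by (cases n) auto
  then obtain k where n: "n = Suc k"
    using not0_implies_Suc by blast
  have *: "(\<Sum>l<n. (sqrt (christoffel q n x) * q l x) * (sqrt (christoffel q n y) * q l y)) =
      sqrt (christoffel q n x) * sqrt (christoffel q n y) * (\<Sum>l<n. q l x * q l y)"
    by (simp add: sum_distrib_left mult_ac)
  show ?thesis
  proof (cases "x = y")
    case True
    then show ?thesis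
      using sum_squares_pos[of q y n] q0 n unfolding *
      by (simp add: christoffel_nonneg) (simp add: christoffel_def power2_eq_square)
  next
    case False
    then show ?thesis
      using christoffel_darboux[OF q[of x] q[of y], of k] x y unfolding * by (simp add: n)
  qed
qed

section \<open>Orthogonal matrices\<close>

text \<open>A right inverse of a square matrix is also a left inverse.\<close>

lemma orthonormal_rows_imp_columns:
  fixes u :: "nat \<Rightarrow> nat \<Rightarrow> real"
  assumes rows: "\<And>j k. j < n \<Longrightarrow> k < n \<Longrightarrow> (\<Sum>l<n. u j l * u k l) = of_bool (j = k)"
    and "l < n" "m < n"
  shows "(\<Sum>j<n. u j l * u j m) = of_bool (l = m)"
proof -
  define U where "U = Matrix.mat n n (\<lambda>(j, l). u j l)"
  have U: "U \<in> carrier_mat n n" "transpose_mat U \<in> carrier_mat n n"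
    by (auto simp: U_def)
  have "U * transpose_mat U = 1\<^sub>m n"
    using rows by (intro eq_matI) (auto simp: U_def scalar_prod_def atLeast0LessThan)
  then have "transpose_mat U * U = 1\<^sub>m n"
    by (rule mat_mult_left_right_inverse[OF U])
  then have "(transpose_mat U * U) $$ (l, m) = of_bool (l = m)"
    using assms by simp
  then show ?thesis
    using assms by (simp add: U_def scalar_prod_def atLeast0LessThan)
qed

text \<open>This expands \<open>w i\<close> in the orthonormal basis \<open>u\<close>; the sum over
  \<open>j\<close> collapses because the columns of \<open>u\<close> are orthonormal too.\<close>

lemma change_of_basis_inverse:
  fixes u w :: "nat \<Rightarrow> nat \<Rightarrow> real"
  assumes u: "\<And>j k. j < n \<Longrightarrow> k < n \<Longrightarrow> (\<Sum>l<n. u j l * u k l) = of_bool (j = k)"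
    and "m < n"
  shows "(\<Sum>j<n. (\<Sum>l<n. w i l * u j l) * u j m) = w i m"
proof -
  have "(\<Sum>j<n. (\<Sum>l<n. w i l * u j l) * u j m) = (\<Sum>l<n. w i l * (\<Sum>j<n. u j l * u j m))"
    unfolding sum_distrib_left sum_distrib_right
    by (subst sum.swap) (simp add: mult_ac)
  also have "\<dots> = (\<Sum>l<n. w i l * of_bool (l = m))"
    using orthonormal_rows_imp_columns[OF u] \<open>m < n\<close> by simp
  also have "\<dots> = w i m"
    using \<open>m < n\<close> by simp
  finally show ?thesis .
qed

text \<open>Parseval's identity: passing to coordinates in the basis \<open>u\<close> preserves
  inner products.\<close>

lemma change_of_basis_orthonormal:
  fixes u w :: "nat \<Rightarrow> nat \<Rightarrow> real"
  assumes u: "\<And>j k. j < n \<Longrightarrow> k < n \<Longrightarrow> (\<Sum>l<n. u j l * u k l) = of_bool (j = k)"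
    and w: "\<And>j k. j < n \<Longrightarrow> k < n \<Longrightarrow> (\<Sum>l<n. w j l * w k l) = of_bool (j = k)"
    and "i < n" "k < n"
  shows "(\<Sum>j<n. (\<Sum>l<n. w i l * u j l) * (\<Sum>l<n. w k l * u j l)) = of_bool (i = k)"
proof -
  have "(\<Sum>j<n. (\<Sum>l<n. w i l * u j l) * (\<Sum>m<n. w k m * u j m)) =
      (\<Sum>m<n. (\<Sum>j<n. (\<Sum>l<n. w i l * u j l) * u j m) * w k m)"
    unfolding sum_distrib_left[of "sum _ _"] sum_distrib_right[of _ "{..<n}" "w k _"]
    by (subst sum.swap) (simp add: mult_ac)
  also have "\<dots> = (\<Sum>m<n. w i m * w k m)"
    using change_of_basis_inverse[OF u] by simp
  finally show ?thesis
    using w assms(3,4) by simp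
qed

lemma doubly_stochastic_squares:
  fixes v :: "nat \<Rightarrow> nat \<Rightarrow> real"
  assumes v: "\<And>j k. j < n \<Longrightarrow> k < n \<Longrightarrow> (\<Sum>l<n. v j l * v k l) = of_bool (j = k)"
  shows "doubly_stochastic (Matrix.mat n n (\<lambda>(i, j). (v i j)\<^sup>2))"
proof -
  have "(\<Sum>j<n. (v i j)\<^sup>2) = 1" if "i < n" for i
    using v[OF that that] by (simp add: power2_eq_square)
  moreover have "(\<Sum>i<n. (v i j)\<^sup>2) = 1" if "j < n" for j
    using orthonormal_rows_imp_columns[OF v that that] by (simp add: power2_eq_square)
  ultimately show ?thesis
    by (simp add: doubly_stochastic_def)
qed

section \<open>Orthonormal polynomials\<close>

text \<open>Dividing \<open>q\<close> by \<open>[:-z, 1:]\<close> leaves the remainder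
  \<open>poly q z\<close>; differentiating that division at \<open>z\<close> gives the diagonal
  value. Being polynomial in \<open>x\<close>, the difference quotient is integrable.\<close>

lemma diff_quot_eq: "diff_quot q z x = poly (synthetic_div q z) x"
proof (cases "x = z")
  case True
  have "poly (pderiv q) z = poly (pderiv ([:-z, 1:] * synthetic_div q z + [:poly q z:])) z"
    by (simp only: synthetic_div_correct')
  also have "\<dots> = poly (synthetic_div q z) z"
    by (simp only: pderiv_add pderiv_mult) (simp add: pderiv_pCons)
  finally show ?thesis
    using True by (simp add: diff_quot_def)
next
  case False
  have "poly q x = poly ([:-z, 1:] * synthetic_div q z + [:poly q z:]) x"
    by (simp only: synthetic_div_correct')
  then have "poly q z - poly q x = (z - x) * poly (synthetic_div q z) x"
    by (simp add: algebra_simps)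
  then show ?thesis
    using False by (simp add: diff_quot_def)
qed

lemma diff_quot_add: "diff_quot (q + r) z x = diff_quot q z x + diff_quot r z x"
  by (simp add: diff_quot_def pderiv_add add_divide_distrib[symmetric])

lemma diff_quot_smult: "diff_quot (smult c q) z x = c * diff_quot q z x"
  by (simp add: diff_quot_def pderiv_smult right_diff_distrib)

text \<open>This carries multiplication by the variable over to difference quotients, and with it
  the recurrence. The extra term \<open>poly q x\<close> will integrate to zero.\<close>

lemma diff_quot_pCons_0: "diff_quot (pCons 0 q) z x = z * diff_quot q z x + poly q x"
  using arg_cong[OF synthetic_div_correct'[of z q], of "\<lambda>q. poly q x"]
  by (simp add: diff_quot_eq algebra_simps)

section \<open>Expansion in orthonormal polynomials and the recurrence coefficients\<close>

locale orthonormal_sequence = prob_space M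
  for M :: "real measure" +
  fixes p :: "nat \<Rightarrow> real poly"
  assumes moments: "\<And>k :: nat. integrable M (\<lambda>x. x ^ k)"
    and orthonormal: "orthonormal_polys M p"
begin

abbreviation "a \<equiv> recur_a M p"
abbreviation "b \<equiv> recur_b M p"

definition E :: "real poly \<Rightarrow> real" where
  "E q = (\<integral>x. poly q x \<partial>M)"

lemma integrable_poly [simp]: "integrable M (poly q)"
  unfolding poly_altdef using moments by (auto intro!: Bochner_Integration.integrable_sum)

lemma E_smult: "E (smult c q) = c * E q"
  by (simp add: E_def)

lemma E_sum: "E (sum f S) = (\<Sum>s\<in>S. E (f s))"
  by (simp add: E_def poly_sum)

lemma degree_p [simp]: "degree (p m) = m"
  and lead_coeff_p: "0 < coeff (p m) m"
  using orthonormal unfolding orthonormal_polys_def by metis+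

lemma E_p_p: "E (p m * p l) = of_bool (m = l)"
  using orthonormal by (simp add: orthonormal_polys_def E_def)

lemma p_0: "p 0 = 1"
proof -
  obtain c where c: "p 0 = [:c:]"
    by (metis degree_0_id degree_p degree_eq_zeroE)
  then have "0 < c" "c * c = 1"
    using lead_coeff_p[of 0] E_p_p[of 0 0] by (simp_all add: E_def prob_space)
  then have "c = 1"
    by (auto simp: square_eq_1_iff)
  then show ?thesis
    using c by simp
qed

text \<open>Subtracting the multiple of \<open>p k\<close> that cancels the leading term lowers the
  degree. The alternative \<open>q = 0\<close> serves \<open>k = 0\<close>, since the zero
  polynomial also has degree \<open>0\<close>.\<close>

lemma expansion_exists:
  assumes "degree q < k \<or> q = 0"
  shows "\<exists>c. q = (\<Sum>l<k. smult (c l) (p l))"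
  using assms
proof (induction k arbitrary: q)
  case (Suc k)
  define t where "t = coeff q k / coeff (p k) k"
  define r where "r = q - smult t (p k)"
  have "coeff r i = 0" if "k \<le> i" for i
  proof (cases "i = k")
    case True
    then show ?thesis
      using lead_coeff_p[of k] by (simp add: r_def t_def)
  next
    case False
    then have "coeff q i = 0" "coeff (p k) i = 0"
      using Suc.prems that by (auto intro!: coeff_eq_0)
    then show ?thesis by (simp add: r_def)
  qed
  then have "degree r < k \<or> r = 0"
    by (metis leading_coeff_0_iff linorder_not_le)
  then obtain c where c: "r = (\<Sum>l<k. smult (c l) (p l))"
    using Suc.IH by blast
  then have "q = (\<Sum>l<Suc k. smult ((c(k := t)) l) (p l))"
    by (simp add: r_def algebra_simps)
  then show ?case by blast
qed auto

lemma expansion: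
  assumes "degree q < k"
  shows "q = (\<Sum>l<k. smult (E (q * p l)) (p l))"
proof -
  obtain c where c: "q = (\<Sum>l<k. smult (c l) (p l))"
    using expansion_exists assms by blast
  have "E (q * p m) = c m" if "m < k" for m
    using that by (subst c) (simp add: sum_distrib_right E_sum E_smult E_p_p)
  then show ?thesis
    using c by simp
qed

lemma E_mult_p_eq_0:
  assumes "degree q < m"
  shows "E (q * p m) = 0"
  by (subst expansion[OF assms]) (simp add: sum_distrib_right E_sum E_smult E_p_p)

lemma a_Suc_eq: "a (Suc m) = E (pCons 0 (p m) * p (Suc m))"
  by (simp add: recur_a_def E_def mult_ac)

lemma b_eq: "b m = E (pCons 0 (p m) * p m)"
  by (simp add: recur_b_def E_def mult_ac power2_eq_square)

lemma degree_shift: "degree (pCons 0 (p m)) < Suc (Suc m)"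
  using degree_pCons_le[of 0 "p m"] by simp

lemma recurrence_0: "pCons 0 (p 0) = smult (a 1) (p 1) + smult (b 0) (p 0)"
proof -
  have "pCons 0 (p 0) = (\<Sum>l<Suc (Suc 0). smult (E (pCons 0 (p 0) * p l)) (p l))"
    by (rule expansion[OF degree_shift])
  also have "\<dots> = smult (a 1) (p 1) + smult (b 0) (p 0)"
    by (simp add: a_Suc_eq b_eq)
  finally show ?thesis .
qed

text \<open>Multiplication by the variable is symmetric under \<open>E\<close>. Hence the
  coefficient at \<open>p l\<close> with \<open>l < m\<close> pairs \<open>p (Suc m)\<close> with a
  polynomial of lower degree and vanishes.\<close>

lemma recurrence_Suc:
  "pCons 0 (p (Suc m)) = smult (a (Suc (Suc m))) (p (Suc (Suc m)))
     + smult (b (Suc m)) (p (Suc m)) + smult (a (Suc m)) (p m)"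
proof -
  have swap: "pCons 0 q * r = pCons 0 r * q" for q r :: "real poly"
    by (simp add: mult.commute)
  have "E (pCons 0 (p (Suc m)) * p l) = 0" if "l < m" for l
    using that less_le_trans[OF degree_shift]
    by (subst swap, intro E_mult_p_eq_0) (simp del: degree_pCons_eq_if)
  moreover have "E (pCons 0 (p (Suc m)) * p m) = a (Suc m)"
    unfolding a_Suc_eq by (subst swap) simp
  ultimately have "(\<Sum>l<Suc (Suc (Suc m)). smult (E (pCons 0 (p (Suc m)) * p l)) (p l)) =
      smult (a (Suc (Suc m))) (p (Suc (Suc m))) + smult (b (Suc m)) (p (Suc m))
        + smult (a (Suc m)) (p m)"
    by (simp add: a_Suc_eq[of "Suc m"] b_eq del: mult_pCons_left)
  then show ?thesis
    using expansion[OF degree_shift[of "Suc m"]] by (rule trans[rotated])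
qed

text \<open>Leading coefficients are compared in the recurrence; \<open>a_pos\<close> takes the sign
  from here.\<close>

lemma lead_coeff_recurrence: "coeff (p m) m = a (Suc m) * coeff (p (Suc m)) (Suc m)"
proof (cases m)
  case 0
  then show ?thesis
    using arg_cong[OF recurrence_0, of "\<lambda>q. coeff q 1"] by (simp add: coeff_eq_0)
next
  case (Suc k)
  then show ?thesis
    using arg_cong[OF recurrence_Suc[of k], of "\<lambda>q. coeff q (Suc m)"] by (simp add: coeff_eq_0)
qed

lemma a_pos: "0 < a (Suc m)"
  using lead_coeff_recurrence[of m] lead_coeff_p[of m] lead_coeff_p[of "Suc m"]
  by (metis zero_less_mult_pos2)

lemma three_term_p: "three_term a b x (\<lambda>m. poly (p m) x)"
  unfolding three_term_def
  using arg_cong[OF recurrence_0, of "\<lambda>q. poly q x"]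
    arg_cong[OF recurrence_Suc, of "\<lambda>q. poly q x"] by simp

section \<open>Associated polynomials and their recurrence\<close>

lemma integrable_diff_quot [simp]: "integrable M (diff_quot q z)"
  unfolding diff_quot_eq[abs_def] by simp

lemma E_p: "E (p (Suc m)) = 0"
  using E_p_p[of 0 "Suc m"] by (simp add: p_0)

text \<open>The difference quotient of a linear polynomial is its slope, and \<open>a 1\<close>
  times the leading coefficient of \<open>p 1\<close> is that of \<open>p 0\<close>, namely
  \<open>1\<close>.\<close>

lemma assoc_poly_0: "assoc_poly M p 0 z = 1"
proof -
  have "diff_quot (p 1) z x = coeff (p 1) 1" for x
  proof -
    obtain c d where "p 1 = [:c, d:]"
      using degree1_coeffs degree_p by blast
    then show ?thesis
      by (simp add: diff_quot_eq)
  qed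
  then show ?thesis
    using lead_coeff_recurrence[of 0] by (simp add: assoc_poly_def prob_space p_0)
qed

text \<open>The difference quotient of \<open>recurrence_Suc\<close> is integrated; the extra term
  vanishes because \<open>p (Suc m)\<close> is orthogonal to constants. The last integral is not
  written with \<open>assoc_poly\<close>, which has no index for \<open>m = 0\<close>.\<close>

lemma integral_diff_quot_recurrence:
  "z * assoc_poly M p m z = a (Suc (Suc m)) * assoc_poly M p (Suc m) z
     + b (Suc m) * assoc_poly M p m z
     + a 1 * (a (Suc m) * (\<integral>x. diff_quot (p m) z x \<partial>M))"
proof -
  let ?D = "\<lambda>k. \<integral>x. diff_quot (p k) z x \<partial>M"
  have "(\<integral>x. z * diff_quot (p (Suc m)) z x + poly (p (Suc m)) x \<partial>M) =
      (\<integral>x. a (Suc (Suc m)) * diff_quot (p (Suc (Suc m))) z x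
        + b (Suc m) * diff_quot (p (Suc m)) z x + a (Suc m) * diff_quot (p m) z x \<partial>M)"
    by (simp only: diff_quot_pCons_0[symmetric] recurrence_Suc diff_quot_add diff_quot_smult)
  then have "z * ?D (Suc m) + E (p (Suc m)) =
      a (Suc (Suc m)) * ?D (Suc (Suc m)) + b (Suc m) * ?D (Suc m) + a (Suc m) * ?D m"
    by (simp add: E_def)
  then have "a 1 * (z * ?D (Suc m)) =
      a 1 * (a (Suc (Suc m)) * ?D (Suc (Suc m)) + b (Suc m) * ?D (Suc m) + a (Suc m) * ?D m)"
    by (simp add: E_p)
  then show ?thesis
    unfolding assoc_poly_def by (simp only: ring_distribs mult_ac)
qed

lemma three_term_assoc_poly:
  "three_term (\<lambda>m. a (Suc m)) (\<lambda>m. b (Suc m)) z (\<lambda>m. assoc_poly M p m z)"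
proof -
  \<comment> \<open>For \<open>m = 0\<close> the last integral vanishes, as \<open>p 0\<close> is
    constant; this gives the initial equation.\<close>
  have "diff_quot (p 0) z x = 0" for x
    by (simp add: p_0 diff_quot_def pderiv_1)
  moreover have "a 1 * (a (Suc (Suc m)) * (\<integral>x. diff_quot (p (Suc m)) z x \<partial>M)) =
      a (Suc (Suc m)) * assoc_poly M p m z" for m
    by (simp add: assoc_poly_def)
  ultimately show ?thesis
    using integral_diff_quot_recurrence[of z] by (simp add: three_term_def)
qed

text \<open>At these zeros both products in the bracket of
  \<open>christoffel_darboux_shifted\<close> vanish, so only its boundary term remains.\<close>

lemma shifted_sum_at_zeros:
  assumes x: "poly (p (Suc k)) x = 0" and y: "assoc_poly M p k y = 0"
  shows "(y - x) * (\<Sum>l<k. poly (p (Suc l)) x * assoc_poly M p l y) = - a 1"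
proof -
  obtain k' where k: "k = Suc k'"
    using y assoc_poly_0 by (cases k) auto
  have "(x - y) * (\<Sum>l<k. poly (p (Suc l)) x * assoc_poly M p l y) = a 1"
    using christoffel_darboux_shifted[OF three_term_p three_term_assoc_poly, of x y k'] x y
    by (simp add: k p_0 assoc_poly_0)
  then show ?thesis
    by (simp add: algebra_simps)
qed

lemma orthogonal_entry_square:
  assumes x: "poly (p (Suc k)) x = 0" and y: "assoc_poly M p k y = 0"
    and "0 \<le> c" "0 \<le> d"
  shows "(\<Sum>l<k. (sqrt c * assoc_poly M p l y) * (sqrt d * poly (p (Suc l)) x))\<^sup>2 =
    (a 1)\<^sup>2 * (d * c) / (y - x)\<^sup>2"
proof -
  let ?S = "\<Sum>l<k. poly (p (Suc l)) x * assoc_poly M p l y"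
  have S: "(y - x) * ?S = - a 1"
    by (rule shifted_sum_at_zeros[OF x y])
  \<comment> \<open>The product is nonzero, which excludes a common zero and makes the division
    legitimate.\<close>
  then have "y - x \<noteq> 0"
    using a_pos[of 0] by auto
  then have "?S = - a 1 / (y - x)"
    using S by (simp add: field_simps)
  then have "?S\<^sup>2 = (a 1)\<^sup>2 / (y - x)\<^sup>2"
    by (simp add: power_divide)
  moreover have "(\<Sum>l<k. (sqrt c * assoc_poly M p l y) * (sqrt d * poly (p (Suc l)) x)) =
      sqrt c * sqrt d * ?S"
    by (simp add: sum_distrib_left mult_ac)
  ultimately show ?thesis
    using assms(3,4) by (simp add: power_mult_distrib)
qed

end

section \<open>The two orthonormal bases and the vector identity\<close>

theorem theorem3p1:
  fixes M :: "real measure" and p :: "nat \<Rightarrow> real poly" and n :: nat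
  assumes "prob_space M"
    and "sets M = sets borel"
    and "infinite (measure_support M)"
    and "\<And>k :: nat. integrable M (\<lambda>x. x ^ k)"
    and "orthonormal_polys M p"
    and "n \<ge> 1"
  shows "assoc_zeros_vec M p n = stoch_mat M p n *\<^sub>v zeros_vec p n
    \<and> doubly_stochastic (stoch_mat M p n)"
proof -
  interpret prob_space M by fact
  interpret orthonormal_sequence M p
    by unfold_locales fact+
  obtain k where n: "n = Suc k"
    using \<open>n \<ge> 1\<close> by (cases n) auto
  define P where "P = (\<lambda>l. poly (p l))"
  define Q where "Q = assoc_poly M p"
  define x where "x j = nth_zero (P n) (Suc j)" for j
  define y where "y i = nth_zero (Q k) (Suc i)" for i
  define lam where "lam j = christoffel P n (x j)" for j
  define mu where "mu i = christoffel Q k (y i)" for i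
  define u where "u j l = sqrt (lam j) * P l (x j)" for j l
  \<comment> \<open>The unit vector gets the last index \<open>k\<close> because \<open>b 0\<close>
    is the last entry of the vector. The leading \<open>0\<close> of the other rows aligns
    \<open>Q l'\<close> with \<open>P (Suc l')\<close>, as in the shifted identity.\<close>
  define w where "w i l = (if i = k then of_bool (l = 0)
    else case l of 0 \<Rightarrow> 0 | Suc l' \<Rightarrow> sqrt (mu i) * Q l' (y i))" for i l
  define v where "v i j = (\<Sum>l<n. w i l * u j l)" for i j
  have P0: "P 0 t = 1" and Q0: "Q 0 t = 1" for t
    by (simp_all add: P_def Q_def p_0 assoc_poly_0)
  have P: "three_term a b t (\<lambda>m. P m t)" for t
    unfolding P_def by (rule three_term_p)
  have Q: "three_term (\<lambda>m. a (Suc m)) (\<lambda>m. b (Suc m)) t (\<lambda>m. Q m t)" for t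
    unfolding Q_def by (rule three_term_assoc_poly)
  note zP = nth_zero_three_term[OF a_pos P P0, where n = n, folded x_def]
  note zQ = nth_zero_three_term[OF a_pos Q Q0, where n = k, folded y_def]
  have lam_nonneg: "0 \<le> lam j" and mu_nonneg: "0 \<le> mu j" for j
    by (simp_all add: lam_def mu_def christoffel_nonneg)
  have u: "(\<Sum>l<n. u i l * u j l) = of_bool (i = j)" if "i < n" "j < n" for i j
    unfolding u_def lam_def
    using christoffel_orthonormal[OF P P0 zP(1)[OF that(1)] zP(1)[OF that(2)]] zP(2) that by simp
  have w: "(\<Sum>l<n. w i l * w j l) = of_bool (i = j)" if "i < n" "j < n" for i j
  proof (cases "i = k \<or> j = k")
    case True
    then show ?thesis
      unfolding n sum.lessThan_Suc_shift by (auto simp: w_def)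
  next
    case False
    then have "i < k" "j < k"
      using that n by auto
    then show ?thesis
      unfolding n sum.lessThan_Suc_shift
      using christoffel_orthonormal[OF Q Q0 zQ(1)[of i] zQ(1)[of j]] zQ(2)
      by (simp add: w_def mu_def)
  qed
  have v: "(\<Sum>j<n. v i j * v i' j) = of_bool (i = i')" if "i < n" "i' < n" for i i'
    unfolding v_def by (rule change_of_basis_orthonormal[OF u w that])
  have vu: "(\<Sum>j<n. v i j * u j m) = w i m" if "m < n" for i m
    unfolding v_def by (rule change_of_basis_inverse[OF u that])
  have v_inner: "v i j = (\<Sum>l<k. (sqrt (mu i) * Q l (y i)) * (sqrt (lam j) * P (Suc l) (x j)))"
    if "i < k" for i j
    unfolding v_def n sum.lessThan_Suc_shift using that by (simp add: w_def u_def)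
  \<comment> \<open>As \<open>P 0\<close> is \<open>1\<close>, this entry is
    \<open>sqrt (lam j)\<close>, whose square is the entry in the last row of the matrix.\<close>
  have v_last: "v k j = u j 0" for j
    unfolding v_def n sum.lessThan_Suc_shift by (simp add: w_def)
  have entry: "stoch_entry M p n (Suc i) (Suc j) = (v i j)\<^sup>2" if "i < n" "j < n" for i j
  proof (cases "i = k")
    case True
    then show ?thesis
      using n lam_nonneg[of j]
      by (simp add: stoch_entry_def v_last u_def p_0 Let_def lam_def x_def P_def)
  next
    case False
    then have "i < k"
      using that n by simp
    then have "(v i j)\<^sup>2 = (a 1)\<^sup>2 * (lam j * mu i) / (y i - x j)\<^sup>2"
      unfolding v_inner[OF \<open>i < k\<close>] P_def Q_def
      using zP(1)[OF \<open>j < n\<close>] zQ(1)[OF \<open>i < k\<close>] mu_nonneg lam_nonneg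
      by (intro orthogonal_entry_square) (simp_all add: n P_def Q_def)
    then show ?thesis
      using \<open>i < k\<close> n
      by (simp add: stoch_entry_def Let_def lam_def mu_def x_def y_def P_def Q_def)
  qed
  then have mat: "stoch_mat M p n = Matrix.mat n n (\<lambda>(i, j). (v i j)\<^sup>2)"
    by (intro eq_matI) (simp_all add: stoch_mat_def)
  have ds: "doubly_stochastic (stoch_mat M p n)"
    unfolding mat by (rule doubly_stochastic_squares[OF v])
  have inner: "(\<Sum>j<n. (v i j)\<^sup>2 * x j) = y i" if "i < k" for i
  proof -
    \<comment> \<open>\<open>(y i - x j) * v i j\<close> is proportional to \<open>u j 0\<close>, and row \<open>i\<close> of \<open>v\<close> is orthogonal to \<open>\<lambda>j. u j 0\<close>.\<close>
    have step: "(y i - x j) * v i j = - a 1 * sqrt (mu i) * u j 0" if "j < n" for j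
    proof -
      have "(y i - x j) * v i j =
          sqrt (mu i) * sqrt (lam j) * ((y i - x j) * (\<Sum>l<k. P (Suc l) (x j) * Q l (y i)))"
        unfolding v_inner[OF \<open>i < k\<close>] by (simp add: sum_distrib_left mult_ac)
      also have "\<dots> = sqrt (mu i) * sqrt (lam j) * (- a 1)"
        using shifted_sum_at_zeros[of k "x j" "y i"] zP(1)[OF that] zQ(1)[OF \<open>i < k\<close>]
        by (simp add: n P_def Q_def)
      finally show ?thesis
        by (simp add: u_def P0)
    qed
    have "(y i - x j) * (v i j)\<^sup>2 = - a 1 * sqrt (mu i) * (v i j * u j 0)" if "j < n" for j
      using arg_cong[OF step[OF that], of "\<lambda>t. t * v i j"]
      by (simp add: power2_eq_square mult_ac)
    then have "(\<Sum>j<n. (y i - x j) * (v i j)\<^sup>2) = - a 1 * sqrt (mu i) * (\<Sum>j<n. v i j * u j 0)"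
      by (simp add: sum_distrib_left)
    \<comment> \<open>By \<open>vu\<close> the sum is the padding coordinate
      \<open>w i 0\<close>.\<close>
    also have "\<dots> = 0"
      using vu[of 0 i] that n by (simp add: w_def)
    finally have "(\<Sum>j<n. (y i - x j) * (v i j)\<^sup>2) = 0" .
    moreover have "(y i - x j) * (v i j)\<^sup>2 = y i * (v i j * v i j) - (v i j)\<^sup>2 * x j" for j
      by (simp add: power2_eq_square algebra_simps)
    ultimately have "(\<Sum>j<n. (v i j)\<^sup>2 * x j) = y i * (\<Sum>j<n. v i j * v i j)"
      by (simp add: sum_subtractf flip: sum_distrib_left)
    then show ?thesis
      using v[of i i] that n by simp
  qed
  have last: "(\<Sum>j<n. (v k j)\<^sup>2 * x j) = b 0"
  proof -
    \<comment> \<open>This is the first row of the eigenvector equation for the Jacobi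
      matrix.\<close>
    have step: "x j * u j 0 = a 1 * u j 1 + b 0 * u j 0" for j
    proof -
      have "x j * u j 0 = sqrt (lam j) * (x j * P 0 (x j))"
        by (simp add: u_def mult_ac)
      also have "\<dots> = a 1 * u j 1 + b 0 * u j 0"
        unfolding three_term_0[OF P] by (simp add: u_def algebra_simps)
      finally show ?thesis .
    qed
    have "(v k j)\<^sup>2 * x j = a 1 * (v k j * u j 1) + b 0 * (v k j * v k j)" for j
      unfolding v_last using arg_cong[OF step[of j], of "\<lambda>t. u j 0 * t"]
      by (simp add: power2_eq_square algebra_simps)
    then have "(\<Sum>j<n. (v k j)\<^sup>2 * x j) =
        a 1 * (\<Sum>j<n. v k j * u j 1) + b 0 * (\<Sum>j<n. v k j * v k j)"
      by (simp add: sum.distrib sum_distrib_left)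
    moreover have "(\<Sum>j<n. v k j * u j 1) = 0"
    \<comment> \<open>By \<open>vu\<close> the sum is the coordinate \<open>w k 1\<close>, which is
      \<open>0\<close>. For \<open>k = 0\<close> there is no coordinate \<open>1\<close>; instead
      \<open>u 0 1\<close> vanishes because \<open>x 0\<close> is a zero of
      \<open>P 1\<close>.\<close>
    proof (cases k)
      case 0
      then have "u 0 1 = 0"
        using zP(1)[of 0] n by (simp add: u_def)
      then show ?thesis
        using 0 n by simp
    next
      case Suc
      then show ?thesis
        using vu[of 1 k] n by (simp add: w_def)
    qed
    ultimately show ?thesis
      using v[of k k] n by simp
  qed
  have "assoc_zeros_vec M p n = stoch_mat M p n *\<^sub>v zeros_vec p n"
  proof (rule eq_vecI)
    fix i
    assume "i < dim_vec (stoch_mat M p n *\<^sub>v zeros_vec p n)"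
    then have i: "i < n"
      by (simp add: mat)
    then have "(stoch_mat M p n *\<^sub>v zeros_vec p n) $ i = (\<Sum>j<n. (v i j)\<^sup>2 * x j)"
      by (simp add: mat zeros_vec_def scalar_prod_def atLeast0LessThan x_def P_def)
    then show "assoc_zeros_vec M p n $ i = (stoch_mat M p n *\<^sub>v zeros_vec p n) $ i"
      using i n inner[of i] last by (cases "i = k") (auto simp: assoc_zeros_vec_def y_def Q_def)
  qed (simp add: assoc_zeros_vec_def mat)
  then show ?thesis
    using ds by blast
qed

end
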